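(* Let $\Omega,\Omega_f,V,W,Q$ and the finite element spaces $V_h\subset V$, $W_h\subset W$, $Q_h=W_h$, $\mathbb{V}_h=V_h\times W_h$ be as in the context. Assume that the $L^2$ projection $P_W\colon W\to W_h\subset L^2(\Omega_f)^3$ is continuous and $H^1$-stable, i.e. there exists a positive constant $c_W$ (independent of $h$) such that for all $w\in W$ $$\|\nabla(P_Ww)\|_{L^2(\Omega_f)}\le c_W\|\nabla w\|_{L^2(\Omega_f)} .$$ Then there exists a constant $\alpha_3>0$, independent of $h$, such that $$\inf_{0\ne q_h\in Q_h}\ \sup_{0\ne(v_h,w_h)\in\mathbb{V}_h}\frac{\langle q_h, v_h|_{\Omega_f}-w_h\rangle}{\|(v_h,w_h)\|_{\mathbb{V}}\,\|q_h\|_{Q}}\ \ge\ \alpha_3 .$$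
   Context: $\Omega\subset\mathbb{R}^3$ is a connected, bounded, Lipschitz domain; $\Omega_f\subset\Omega$ is a union of finitely many (possibly overlapping) connected Lipschitz domains; $\hat\Omega=\Omega\setminus\Omega_f$ is a connected Lipschitz domain. $B_e=\partial\Omega\cap\partial\Omega_f$. $V=\{v\in H^1(\Omega)^3: v|_{\partial\Omega}=0\}$ and $W=\{w\in H^1(\Omega_f)^3: w|_{B_e}=0\}$, with norms $\|v\|_V=\|v\|_{L^2(\Omega)}+\|\nabla v\|_{L^2(\Omega)}$ and $\|w\|_W=\|w\|_{L^2(\Omega_f)}+\|\nabla w\|_{L^2(\Omega_f)}$. $Q=W'$ is the dual space of $W$ with the dual norm $\|\cdot\|_Q$; $\langle\cdot,\cdot\rangle$ is the duality pairing between $Q$ and $W$. $\|(v,w)\|_{\mathbb{V}}^2=\|v\|_V^2+\|w\|_W^2$. $V_h\subset V$ and $W_h\subset W$ are finite element spaces on independent regular families of meshes of $\Omega$ and $\Omega_f$ (no geometrical error in the meshing), $h$ being the maximum element diameter. $Q_h=W_h$, an element $q_h\in W_h$ being regarded as an element of $Q$ through the $L^2$ product: $\langle q_h,w\rangle=(q_h,w)_{L^2(\Omega_f)}$. All discrete spaces carry the norms of their continuous counterparts. *)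

theory Defs
  imports "HOL-Analysis.Analysis"
begin

definition lipschitz_boundary :: "(real^3) set \<Rightarrow> bool" where
  "lipschitz_boundary U \<longleftrightarrow>
     (\<forall>x\<in>frontier U. \<exists>r>0. \<exists>T :: real^3 \<Rightarrow> real^3. \<exists>\<gamma> :: real^2 \<Rightarrow> real. \<exists>L.
        orthogonal_transformation T \<and> L-lipschitz_on UNIV \<gamma> \<and>
        (\<forall>y\<in>ball x r. y \<in> U \<longleftrightarrow> \<gamma> (vector [T y $ 1, T y $ 2]) < T y $ 3))"

definition lipschitz_domain :: "(real^3) set \<Rightarrow> bool" where
  "lipschitz_domain U \<longleftrightarrow> open U \<and> connected U \<and> U \<noteq> {} \<and> lipschitz_boundary U"

text \<open>Elements of the function spaces over an open set \<^term>\<open>U\<close> are represented by total functions on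
  the whole of space. Everything below depends only on their values almost everywhere in
  \<^term>\<open>U\<close>, so restriction to a subdomain is implicit.\<close>

definition ae_zero :: "(real^3) set \<Rightarrow> (real^3 \<Rightarrow> 'b::real_normed_vector) \<Rightarrow> bool" where
  "ae_zero U f \<longleftrightarrow> (AE x in lebesgue_on U. f x = 0)"

definition L2_space :: "(real^3) set \<Rightarrow> (real^3 \<Rightarrow> 'b::euclidean_space) set" where
  "L2_space U = {f \<in> borel_measurable (lebesgue_on U).
                   integrable (lebesgue_on U) (\<lambda>x. (norm (f x))\<^sup>2)}"

definition L2_inner :: "(real^3) set \<Rightarrow> (real^3 \<Rightarrow> 'b::euclidean_space) \<Rightarrow> (real^3 \<Rightarrow> 'b) \<Rightarrow> real" where
  "L2_inner U f g = (\<integral>x. f x \<bullet> g x \<partial>lebesgue_on U)"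

text \<open>For matrix-valued functions the pointwise norm is the Frobenius norm.\<close>

definition L2_norm :: "(real^3) set \<Rightarrow> (real^3 \<Rightarrow> 'b::euclidean_space) \<Rightarrow> real" where
  "L2_norm U f = sqrt (\<integral>x. (norm (f x))\<^sup>2 \<partial>lebesgue_on U)"

definition partial_deriv :: "3 \<Rightarrow> (real^3 \<Rightarrow> 'b::real_normed_vector) \<Rightarrow> real^3 \<Rightarrow> 'b" where
  "partial_deriv j f x = frechet_derivative f (at x) (axis j 1)"

primrec Ck :: "nat \<Rightarrow> (real^3 \<Rightarrow> 'b::real_normed_vector) \<Rightarrow> bool" where
  "Ck 0 f \<longleftrightarrow> continuous_on UNIV f"
| "Ck (Suc k) f \<longleftrightarrow> (\<forall>x. f differentiable (at x)) \<and> (\<forall>j. Ck k (partial_deriv j f))"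

definition smooth :: "(real^3 \<Rightarrow> 'b::real_normed_vector) \<Rightarrow> bool" where
  "smooth f \<longleftrightarrow> (\<forall>k. Ck k f)"

definition test_function :: "(real^3) set \<Rightarrow> (real^3 \<Rightarrow> real) \<Rightarrow> bool" where
  "test_function U \<phi> \<longleftrightarrow> smooth \<phi> \<and> (\<exists>K. compact K \<and> K \<subseteq> U \<and> (\<forall>x. x \<notin> K \<longrightarrow> \<phi> x = 0))"

definition locally_integrable :: "(real^3) set \<Rightarrow> (real^3 \<Rightarrow> 'b::euclidean_space) \<Rightarrow> bool" where
  "locally_integrable U f \<longleftrightarrow> (\<forall>K. compact K \<and> K \<subseteq> U \<longrightarrow> integrable (lebesgue_on K) f)"

text \<open>The entry \<^term>\<open>G x $ i $ j\<close> is the weak derivative of the i-th component in direction j.\<close>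

definition has_weak_grad ::
    "(real^3) set \<Rightarrow> (real^3 \<Rightarrow> real^3) \<Rightarrow> (real^3 \<Rightarrow> real^3^3) \<Rightarrow> bool" where
  "has_weak_grad U v G \<longleftrightarrow> locally_integrable U v \<and> locally_integrable U G \<and>
     (\<forall>\<phi> i j. test_function U \<phi> \<longrightarrow>
        (\<integral>x. v x $ i * partial_deriv j \<phi> x \<partial>lebesgue_on U)
          = - (\<integral>x. G x $ i $ j * \<phi> x \<partial>lebesgue_on U))"

text \<open>A representative of the weak gradient, which is unique almost everywhere in
  \<^term>\<open>U\<close>.\<close>

definition weak_grad :: "(real^3) set \<Rightarrow> (real^3 \<Rightarrow> real^3) \<Rightarrow> real^3 \<Rightarrow> real^3^3" where
  "weak_grad U v = (SOME G. has_weak_grad U v G)"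

definition H1_space :: "(real^3) set \<Rightarrow> (real^3 \<Rightarrow> real^3) set" where
  "H1_space U = {v \<in> L2_space U. \<exists>G \<in> L2_space U. has_weak_grad U v G}"

definition H1_norm :: "(real^3) set \<Rightarrow> (real^3 \<Rightarrow> real^3) \<Rightarrow> real" where
  "H1_norm U v = L2_norm U v + L2_norm U (weak_grad U v)"

text \<open>Two-dimensional Hausdorff measure on the Borel sets; the factor is the area of a disc of unit
  diameter, so on Lipschitz surfaces this is the surface area.\<close>

definition hausdorff2_outer :: "(real^3) set \<Rightarrow> ennreal" where
  "hausdorff2_outer A =
     (SUP \<delta>\<in>{0::real<..}.
        INF C\<in>{C :: nat \<Rightarrow> (real^3) set.
                A \<subseteq> (\<Union>i. C i) \<and> (\<forall>i. bounded (C i) \<and> diameter (C i) \<le> \<delta>)}.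
          (\<Sum>i. ennreal (pi / 4 * (diameter (C i))\<^sup>2)))"

definition surface_measure :: "(real^3) measure" where
  "surface_measure = measure_of UNIV (sets borel) hausdorff2_outer"

text \<open>The trace operator of a bounded Lipschitz domain D is the continuous extension, from H1 of D to
  L2 of the boundary, of the restriction map on functions that are smooth up to the boundary.\<close>

definition has_trace ::
    "(real^3) set \<Rightarrow> (real^3 \<Rightarrow> real^3) \<Rightarrow> (real^3 \<Rightarrow> real^3) \<Rightarrow> bool" where
  "has_trace D v g \<longleftrightarrow> g \<in> borel_measurable borel \<and>
     (\<exists>\<phi> :: nat \<Rightarrow> real^3 \<Rightarrow> real^3. (\<forall>n. smooth (\<phi> n)) \<and>
        (\<lambda>n. H1_norm D (\<lambda>x. \<phi> n x - v x)) \<longlonglongrightarrow> 0 \<and>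
        (\<lambda>n. \<integral>\<^sup>+x\<in>frontier D. ennreal ((norm (\<phi> n x - g x))\<^sup>2) \<partial>surface_measure) \<longlonglongrightarrow> 0)"

text \<open>A finite union U of Lipschitz domains need not itself be Lipschitz, so the condition
  that v vanishes on a part \<open>\<Gamma>\<close> of its boundary is imposed on the trace of v from each of the
  domains in the family \<open>\<D>\<close> composing U.\<close>

definition H1_vanishing ::
    "(real^3) set set \<Rightarrow> (real^3) set \<Rightarrow> (real^3 \<Rightarrow> real^3) set" where
  "H1_vanishing \<D> \<Gamma> = {v \<in> H1_space (\<Union>\<D>). \<forall>D\<in>\<D>. \<exists>g. has_trace D v g \<and>
     (AE x in surface_measure. x \<in> frontier D \<inter> \<Gamma> \<longrightarrow> g x = 0)}"

definition space_V :: "(real^3) set \<Rightarrow> (real^3 \<Rightarrow> real^3) set" where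
  "space_V \<Omega> = H1_vanishing {\<Omega>} (frontier \<Omega>)"

definition space_W :: "(real^3) set \<Rightarrow> (real^3) set set \<Rightarrow> (real^3 \<Rightarrow> real^3) set" where
  "space_W \<Omega> \<D> = H1_vanishing \<D> (frontier \<Omega> \<inter> frontier (\<Union>\<D>))"

definition norm_VW ::
    "(real^3) set \<Rightarrow> (real^3) set \<Rightarrow> (real^3 \<Rightarrow> real^3) \<times> (real^3 \<Rightarrow> real^3) \<Rightarrow> real" where
  "norm_VW \<Omega> \<Omega>f = (\<lambda>(v, w). sqrt ((H1_norm \<Omega> v)\<^sup>2 + (H1_norm \<Omega>f w)\<^sup>2))"

text \<open>An element of the dual of W is a bounded linear functional; the duality pairing is function
  application.\<close>

definition norm_Q ::
    "(real^3) set \<Rightarrow> (real^3) set set \<Rightarrow> ((real^3 \<Rightarrow> real^3) \<Rightarrow> real) \<Rightarrow> real" where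
  "norm_Q \<Omega> \<D> \<Phi> =
     (SUP w\<in>{w \<in> space_W \<Omega> \<D>. \<not> ae_zero (\<Union>\<D>) w}. \<bar>\<Phi> w\<bar> / H1_norm (\<Union>\<D>) w)"

definition L2_functional :: "(real^3) set \<Rightarrow> (real^3 \<Rightarrow> real^3) \<Rightarrow> (real^3 \<Rightarrow> real^3) \<Rightarrow> real" where
  "L2_functional U q = (\<lambda>w. L2_inner U q w)"

text \<open>An element is given by a polyhedral reference cell, a finite set of polynomial maps
  spanning the local shape functions on the reference cell, and a chart mapping the reference cell
  onto the actual cell. This covers simplicial, hexahedral and mixed meshes, with affine or curved
  cells.\<close>

record fin_elem =
  ref_cell :: "(real^3) set"
  ref_basis :: "(real^3 \<Rightarrow> real^3) set"
  chart :: "real^3 \<Rightarrow> real^3"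

definition cell :: "fin_elem \<Rightarrow> (real^3) set" where
  "cell e = chart e ` ref_cell e"

definition wf_fin_elem :: "fin_elem \<Rightarrow> bool" where
  "wf_fin_elem e \<longleftrightarrow>
     polytope (ref_cell e) \<and> interior (ref_cell e) \<noteq> {} \<and>
     finite (ref_basis e) \<and> (\<forall>b\<in>ref_basis e. polynomial_function b) \<and>
     inj_on (chart e) (ref_cell e) \<and>
     (\<exists>N J. open N \<and> ref_cell e \<subseteq> N \<and>
        (\<forall>x\<in>N. (chart e has_derivative (\<lambda>h. (J x :: real^3^3) *v h)) (at x)) \<and>
        continuous_on N J \<and> (\<forall>x\<in>ref_cell e. det (J x) \<noteq> 0))"

definition shape_functions :: "fin_elem \<Rightarrow> (real^3 \<Rightarrow> real^3) set" where
  "shape_functions e = range (\<lambda>c :: (real^3 \<Rightarrow> real^3) \<Rightarrow> real.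
     \<lambda>y. \<Sum>b\<in>ref_basis e. c b *\<^sub>R b (inv_into (ref_cell e) (chart e) y))"

text \<open>The cells cover the closure of U exactly: there is no geometrical error.\<close>

definition is_mesh :: "(real^3) set \<Rightarrow> fin_elem set \<Rightarrow> bool" where
  "is_mesh U \<T> \<longleftrightarrow> finite \<T> \<and> (\<forall>e\<in>\<T>. wf_fin_elem e) \<and> (\<Union>e\<in>\<T>. cell e) = closure U \<and>
     (\<forall>e\<in>\<T>. \<forall>e'\<in>\<T>. e \<noteq> e' \<longrightarrow> interior (cell e) \<inter> interior (cell e') = {})"

definition inner_diameter :: "(real^3) set \<Rightarrow> real" where
  "inner_diameter K = Sup {2 * r | r x. 0 < r \<and> cball x r \<subseteq> K}"

definition regular_mesh_family :: "real set \<Rightarrow> (real^3) set \<Rightarrow> (real \<Rightarrow> fin_elem set) \<Rightarrow> bool" where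
  "regular_mesh_family H U \<T> \<longleftrightarrow> (\<forall>h\<in>H. is_mesh U (\<T> h)) \<and>
     (\<exists>\<sigma>. \<forall>h\<in>H. \<forall>e\<in>\<T> h. diameter (cell e) \<le> \<sigma> * inner_diameter (cell e))"

definition mesh_size :: "fin_elem set \<Rightarrow> real" where
  "mesh_size \<T> = Max ((\<lambda>e. diameter (cell e)) ` \<T>)"

definition linear_function_space :: "(real^3 \<Rightarrow> real^3) set \<Rightarrow> bool" where
  "linear_function_space X \<longleftrightarrow> (\<lambda>_. 0) \<in> X \<and>
     (\<forall>u\<in>X. \<forall>v\<in>X. (\<lambda>x. u x + v x) \<in> X) \<and> (\<forall>c. \<forall>v\<in>X. (\<lambda>x. c *\<^sub>R v x) \<in> X)"

text \<open>A finite element space in Z is a linear space of members of Z that coincide on each cell with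
  a local shape function. Taking a subspace, rather than all such functions,
  leaves room for the constraints by which a given method glues its degrees of freedom
  (matching of derivatives, hanging nodes, boundary values).\<close>

definition fe_space ::
    "(real^3) set \<Rightarrow> fin_elem set \<Rightarrow> (real^3 \<Rightarrow> real^3) set \<Rightarrow> (real^3 \<Rightarrow> real^3) set \<Rightarrow> bool" where
  "fe_space U \<T> Z X \<longleftrightarrow> linear_function_space X \<and> X \<subseteq> Z \<and>
     (\<forall>v\<in>X. \<forall>e\<in>\<T>. \<exists>p\<in>shape_functions e. AE x in lebesgue_on (cell e \<inter> U). v x = p x)"

text \<open>A representative of the L2-orthogonal projection of w onto X, which is unique almost everywhere
  in U.\<close>

definition L2_projection ::
    "(real^3) set \<Rightarrow> (real^3 \<Rightarrow> real^3) set \<Rightarrow> (real^3 \<Rightarrow> real^3) \<Rightarrow> real^3 \<Rightarrow> real^3" where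
  "L2_projection U X w = (SOME p. p \<in> X \<and> (\<forall>q\<in>X. L2_inner U (\<lambda>x. w x - p x) q = 0))"

text \<open>Continuity of an operator from Z, with the H1 norm on U, to L2 of U.\<close>

definition H1_L2_continuous ::
    "(real^3) set \<Rightarrow> (real^3 \<Rightarrow> real^3) set \<Rightarrow> ((real^3 \<Rightarrow> real^3) \<Rightarrow> real^3 \<Rightarrow> real^3) \<Rightarrow> bool" where
  "H1_L2_continuous U Z P \<longleftrightarrow> (\<forall>w\<in>Z. \<forall>\<epsilon>>0. \<exists>\<delta>>0. \<forall>w'\<in>Z.
     H1_norm U (\<lambda>x. w' x - w x) < \<delta> \<longrightarrow> L2_norm U (\<lambda>x. P w' x - P w x) < \<epsilon>)"

end

theory Submission
  imports Defs
begin

text \<open>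
  Given \<open>q\<close> in the discrete space and \<open>w\<close> in \<open>W\<close>, test with \<open>v\<^sub>h = 0\<close> and \<open>w\<^sub>h = \<plusminus> P w\<close>, the sign making
  the pairing nonnegative. Orthogonality of the projection gives \<open>\<langle>q, P w\<rangle> = \<langle>q, w\<rangle>\<close>, and stability in
  L2 (automatic) and H1 (assumed) gives \<open>\<parallel>P w\<parallel> \<le> max 1 c\<^sub>W * \<parallel>w\<parallel>\<close>. Taking the supremum over \<open>w\<close>
  turns the right-hand side into the dual norm of \<open>q\<close>, with \<open>\<alpha>\<^sub>3 = 1 / max 1 c\<^sub>W\<close>.

  Since weak gradients and projections are chosen by an epsilon operator, this needs uniqueness of weak
  gradients (already for the norm of the zero function) and existence of the projection.
\<close>

subsection \<open>Smooth cutoff functions of boxes\<close>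

text \<open>At \<open>k = 0\<close> this is the standard smooth function exp(-1/t) that is flat at
  the origin. The powers of 1/t are carried along so that derivatives are combinations of members of
  the same family.\<close>

definition flat :: "nat \<Rightarrow> real \<Rightarrow> real" where
  "flat k t = (if t \<le> 0 then 0 else (1 / t) ^ k * exp (- (1 / t)))"

text \<open>In the variable 1/t the exponential beats every power. All \<open>k\<close> are covered
  because the difference quotient of \<open>flat k\<close> at 0 is
  \<open>flat (k + 1)\<close>.\<close>

lemma flat_tendsto_0: "(flat k \<longlongrightarrow> 0) (at 0)"
proof -
  have "((\<lambda>t. inverse t ^ k / exp (inverse t)) \<longlongrightarrow> (0::real)) (at_right 0)"
    using tendsto_power_div_exp_0 filterlim_inverse_at_top_right by (rule filterlim_compose)
  then have "(flat k \<longlongrightarrow> 0) (at_right 0)"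
    by (rule Lim_transform_eventually)
      (auto simp: eventually_at_filter flat_def exp_minus field_simps)
  moreover have "(flat k \<longlongrightarrow> 0) (at_left 0)"
    by (rule Lim_transform_eventually[OF tendsto_const])
      (auto simp: eventually_at_filter flat_def)
  ultimately show ?thesis
    by (simp add: filterlim_at_split)
qed

lemma flat_has_derivative:
  "(flat k has_real_derivative flat (k + 2) t - real k * flat (k + 1) t) (at t)"
proof (cases t "0 :: real" rule: linorder_cases)
  case less
  have "((\<lambda>_. 0) has_real_derivative 0) (at t)" by simp
  then have "(flat k has_real_derivative 0) (at t)"
    by (rule DERIV_cong_ev[THEN iffD1, rotated 3])
      (use less in \<open>auto simp: flat_def eventually_nhds intro!: exI[of _ "{..<0}"]\<close>)
  then show ?thesis using less by (simp add: flat_def)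
next
  case equal
  have "((\<lambda>h. (flat k (0 + h) - flat k 0) / h) \<longlongrightarrow> 0) (at 0)"
    by (rule Lim_transform_eventually[OF flat_tendsto_0[of "k + 1"]])
      (auto simp: eventually_at_filter flat_def)
  then show ?thesis
    using equal by (simp add: DERIV_def flat_def)
next
  case greater
  have "((\<lambda>t. (1 / t) ^ k * exp (- (1 / t))) has_real_derivative
      real k * (1 / t) ^ (k - 1) * (- 1 / t\<^sup>2) * exp (- (1 / t))
        + (1 / t) ^ k * (exp (- (1 / t)) * (1 / t\<^sup>2))) (at t)"
    using greater
    by (auto intro!: derivative_eq_intros simp: power2_eq_square)
  also have "real k * (1 / t) ^ (k - 1) * (- 1 / t\<^sup>2) * exp (- (1 / t))
        + (1 / t) ^ k * (exp (- (1 / t)) * (1 / t\<^sup>2)) = flat (k + 2) t - real k * flat (k + 1) t"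
    \<comment> \<open>The case split removes the truncated \<open>k - 1\<close>, whose term has
      coefficient 0 when \<open>k = 0\<close>.\<close>
    using greater by (cases k) (auto simp: flat_def power2_eq_square field_simps)
  finally have "((\<lambda>t. (1 / t) ^ k * exp (- (1 / t))) has_real_derivative
      flat (k + 2) t - real k * flat (k + 1) t) (at t)" .
  then show ?thesis
    by (rule DERIV_cong_ev[THEN iffD1, rotated 3])
      (use greater in \<open>auto simp: flat_def eventually_nhds intro!: exI[of _ "{0<..}"]\<close>)
qed

text \<open>Closed under partial derivatives, so that smoothness of its members is immediate.\<close>

inductive_set flat_algebra :: "(real^3 \<Rightarrow> real) set" where
  const: "(\<lambda>_. c) \<in> flat_algebra"
| flat: "(\<lambda>x. flat k (s * x $ j + c)) \<in> flat_algebra"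
| add: "f \<in> flat_algebra \<Longrightarrow> g \<in> flat_algebra \<Longrightarrow> (\<lambda>x. f x + g x) \<in> flat_algebra"
| mult: "f \<in> flat_algebra \<Longrightarrow> g \<in> flat_algebra \<Longrightarrow> (\<lambda>x. f x * g x) \<in> flat_algebra"

text \<open>The chain rule raises the index of a \<open>flat\<close> factor by one or two, which is
  why the algebra contains every \<open>k\<close>; sums and products follow by linearity and the
  Leibniz rule. A single map \<open>f'\<close> serves all points, so that each directional
  derivative is a function that can be differentiated again.\<close>

lemma flat_algebra_derivative:
  assumes "f \<in> flat_algebra"
  shows "\<exists>f'. \<forall>x. (f has_derivative f' x) (at x) \<and> (\<forall>v. (\<lambda>x. f' x v) \<in> flat_algebra)"
  using assms
proof induction
  case (const c)
  show ?case
    by (rule exI[of _ "\<lambda>_ _. 0"]) (auto intro: flat_algebra.const)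
next
  case (flat k s j c)
  have "((\<lambda>x. flat k (s * x $ j + c)) has_derivative
      (\<lambda>v. (s * v $ j) * (flat (k + 2) (s * x $ j + c) + - real k * flat (k + 1) (s * x $ j + c)))) (at x)" for x :: "real^3"
  proof -
    have "((\<lambda>x::real^3. s * x $ j + c) has_derivative (\<lambda>v. s * v $ j)) (at x)"
      by (auto intro!: derivative_eq_intros bounded_linear_imp_has_derivative bounded_linear_vec_nth)
    from DERIV_compose_FDERIV[OF flat_has_derivative this] show ?thesis
      by simp
  qed
  moreover have "(\<lambda>x. (s * v $ j) * (flat (k + 2) (s * x $ j + c) + - real k * flat (k + 1) (s * x $ j + c))) \<in> flat_algebra" for v :: "real^3"
    by (intro flat_algebra.intros)
  ultimately show ?case
    by (intro exI[of _ "\<lambda>x v. (s * v $ j) * (flat (k + 2) (s * x $ j + c) + - real k * flat (k + 1) (s * x $ j + c))"] allI conjI)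
next
  case (add f g)
  then obtain f' g' where
    f': "\<And>x. (f has_derivative f' x) (at x)" "\<And>v. (\<lambda>x. f' x v) \<in> flat_algebra" and
    g': "\<And>x. (g has_derivative g' x) (at x)" "\<And>v. (\<lambda>x. g' x v) \<in> flat_algebra"
    by blast
  show ?case
    using has_derivative_add[OF f'(1) g'(1)] flat_algebra.add[OF f'(2) g'(2)]
    by (intro exI[of _ "\<lambda>x v. f' x v + g' x v"] allI conjI)
next
  case (mult f g)
  then obtain f' g' where
    f': "\<And>x. (f has_derivative f' x) (at x)" "\<And>v. (\<lambda>x. f' x v) \<in> flat_algebra" and
    g': "\<And>x. (g has_derivative g' x) (at x)" "\<And>v. (\<lambda>x. g' x v) \<in> flat_algebra"
    by blast
  show ?case
    using has_derivative_mult[OF f'(1) g'(1)]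
      flat_algebra.add[OF flat_algebra.mult[OF mult.hyps(1) g'(2)] flat_algebra.mult[OF f'(2) mult.hyps(2)]]
    by (intro exI[of _ "\<lambda>x v. f x * g' x v + f' x v * g x"] allI conjI)
qed

lemma flat_algebra_Ck: "f \<in> flat_algebra \<Longrightarrow> Ck k f"
proof (induction k arbitrary: f)
  case 0
  from flat_algebra_derivative[OF 0] obtain f' where "\<And>x. (f has_derivative f' x) (at x)"
    by blast
  then have "isCont f x" for x
    by (rule has_derivative_continuous)
  then show ?case by (simp add: continuous_at_imp_continuous_on)
next
  case (Suc k)
  from flat_algebra_derivative[OF Suc.prems] obtain f' where
    f': "\<And>x. (f has_derivative f' x) (at x)" "\<And>v. (\<lambda>x. f' x v) \<in> flat_algebra"
    by blast
  have "partial_deriv j f = (\<lambda>x. f' x (axis j 1))" for j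
    unfolding partial_deriv_def by (simp flip: frechet_derivative_at[OF f'(1)])
  then show ?case
    using f' Suc.IH by (auto simp: differentiable_def)
qed

lemma flat_algebra_smooth: "f \<in> flat_algebra \<Longrightarrow> smooth f"
  by (simp add: smooth_def flat_algebra_Ck)

lemma flat_algebra_power: "f \<in> flat_algebra \<Longrightarrow> (\<lambda>x. f x ^ n) \<in> flat_algebra"
  using flat_algebra.const[of 1] flat_algebra.mult[of f] by (induction n) simp_all

lemma flat_algebra_prod:
  "finite J \<Longrightarrow> (\<And>j. j \<in> J \<Longrightarrow> f j \<in> flat_algebra) \<Longrightarrow> (\<lambda>x. \<Prod>j\<in>J. f j x) \<in> flat_algebra"
proof (induction J rule: finite_induct)
  case empty
  show ?case using flat_algebra.const[of 1] by simp
next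
  case (insert i J)
  then show ?case using flat_algebra.mult[of "f i" "\<lambda>x. \<Prod>j\<in>J. f j x"] by simp
qed

text \<open>A smooth function positive exactly on the open box: a pair of factors vanishes unless
  \<open>x $ j\<close> lies strictly between \<open>a $ j\<close> and \<open>b $ j\<close>. The
  coefficients \<open>1\<close> and \<open>- 1\<close> bring the arguments into the shape of the
  rule \<open>flat\<close>.\<close>

definition box_bump :: "real^3 \<Rightarrow> real^3 \<Rightarrow> real^3 \<Rightarrow> real" where
  "box_bump a b x = (\<Prod>j\<in>UNIV. flat 0 (1 * x $ j + - a $ j) * flat 0 (- 1 * x $ j + b $ j))"

lemma flat_0_bounds: "0 \<le> flat 0 t" "flat 0 t < 1" "0 < flat 0 t \<longleftrightarrow> 0 < t"
  by (auto simp: flat_def)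

lemma box_bump_bounds: "0 \<le> box_bump a b x" "box_bump a b x \<le> 1"
  unfolding box_bump_def
  by (auto intro!: prod_nonneg prod_le_1 mult_le_one less_imp_le[OF flat_0_bounds(2)]
      simp: flat_0_bounds(1))

lemma box_bump_pos: "x \<in> box a b \<Longrightarrow> 0 < box_bump a b x"
  unfolding box_bump_def
  by (auto intro!: prod_pos mult_pos_pos simp: flat_0_bounds(3) mem_box_cart)

lemma box_bump_eq_0: "x \<notin> box a b \<Longrightarrow> box_bump a b x = 0"
  unfolding box_bump_def
  by (auto simp: mem_box_cart flat_def not_less intro!: prod_zero)

text \<open>Sums with negative coefficients replace differences, to match the rules of \<open>flat_algebra\<close>. The powers
  of a number in \<open>[0, 1)\<close> tend to 0, so the cutoffs tend to the indicator of the box.\<close>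

definition box_cutoff :: "real^3 \<Rightarrow> real^3 \<Rightarrow> nat \<Rightarrow> real^3 \<Rightarrow> real" where
  "box_cutoff a b n x = 1 + (- 1) * (1 + (- 1) * box_bump a b x) ^ n"

lemma smooth_box_cutoff: "smooth (box_cutoff a b n)"
proof -
  have "(\<lambda>x. box_bump a b x) \<in> flat_algebra"
    unfolding box_bump_def by (intro flat_algebra_prod flat_algebra.intros) auto
  then have "(\<lambda>x. box_cutoff a b n x) \<in> flat_algebra"
    unfolding box_cutoff_def by (intro flat_algebra.intros flat_algebra_power)
  then show ?thesis by (simp add: flat_algebra_smooth)
qed

lemma box_cutoff_bounds: "0 \<le> box_cutoff a b n x" "box_cutoff a b n x \<le> 1"
  using box_bump_bounds[of a b x] by (auto simp: box_cutoff_def intro!: power_le_one)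

lemma box_cutoff_eq_0: "x \<notin> box a b \<Longrightarrow> box_cutoff a b n x = 0"
  by (simp add: box_cutoff_def box_bump_eq_0)

lemma box_cutoff_tendsto: "(\<lambda>n. box_cutoff a b n x) \<longlonglongrightarrow> indicat_real (box a b) x"
proof (cases "x \<in> box a b")
  case True
  have "(\<lambda>n. (1 + (- 1) * box_bump a b x) ^ n) \<longlonglongrightarrow> 0"
    using box_bump_pos[OF True] box_bump_bounds[of a b x] by (intro LIMSEQ_realpow_zero) auto
  from tendsto_diff[OF tendsto_const[of 1] this] show ?thesis
    using True by (simp add: box_cutoff_def)
qed (simp add: box_cutoff_eq_0)

text \<open>The cutoff vanishes off the open box, but the support of a test function has to sit in a
  compact subset of \<open>U\<close>; the closed box is that subset.\<close>

lemma test_function_box_cutoff: "cbox a b \<subseteq> U \<Longrightarrow> test_function U (box_cutoff a b n)"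
  unfolding test_function_def
  using box_subset_cbox[of a b]
  by (intro conjI smooth_box_cutoff exI[of _ "cbox a b"]) (auto intro: box_cutoff_eq_0)

subsection \<open>Uniqueness of weak gradients\<close>

text \<open>Boxes form an intersection-stable generator of the Borel sets, so vanishing integrals
  over boxes spread to all Borel sets by Dynkin's argument. An integrable function with that
  property is zero almost everywhere.\<close>

lemma AE_eq_0_if_box_integrals_eq_0:
  fixes f :: "'a::euclidean_space \<Rightarrow> real"
  assumes int: "integrable lebesgue f"
    and supp: "\<And>x. x \<notin> box a b \<Longrightarrow> f x = 0"
    and boxes: "\<And>c d. (\<integral>x. indicator (box c d) x * f x \<partial>lebesgue) = 0"
  shows "AE x in lebesgue. f x = 0"
proof -
  \<comment> \<open>Dynkin's argument runs on Borel sets, so \<open>f\<close> is replaced by a Borel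
    function equal to it almost everywhere.\<close>
  obtain g where g: "g \<in> borel_measurable lborel" and fg: "AE x in lborel. f x = g x"
    using completion_ex_borel_measurable_real borel_measurable_integrable[OF int] by blast
  note fg' = AE_completion[OF fg]
  have g': "g \<in> borel_measurable lebesgue"
    using g by (rule measurable_completion)
  have "integrable lebesgue g"
    using int integrable_cong_AE[OF borel_measurable_integrable[OF int] g' fg'] by simp
  then have int_g: "integrable lborel g"
    using integrable_completion[OF g] by simp
  have set_int: "(\<integral>x. indicator A x * f x \<partial>lebesgue) = (LINT x:A|lborel. g x)"
    if "A \<in> sets borel" for A
  proof -
    have "(\<lambda>x. indicator A x * g x) \<in> borel_measurable lborel"
      using g that by measurable
    then have "(\<integral>x. indicator A x * g x \<partial>lebesgue) = (LINT x:A|lborel. g x)"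
      unfolding set_lebesgue_integral_def real_scaleR_def by (rule integral_completion)
    moreover have "(\<integral>x. indicator A x * f x \<partial>lebesgue) = (\<integral>x. indicator A x * g x \<partial>lebesgue)"
      using fg' borel_measurable_integrable[OF int] g' that
      by (intro integral_cong_AE) (auto intro!: borel_measurable_times borel_measurable_indicator intro: sets_completionI_sets)
    ultimately show ?thesis by simp
  qed
  \<comment> \<open>The whole space is no box, but its integral is that over \<open>box a b\<close>,
    outside which \<open>f\<close> vanishes. The complement step of the induction rests on
    this.\<close>
  have total: "(LINT x:UNIV|lborel. g x) = 0"
  proof -
    have "(LINT x:UNIV|lborel. g x) = (\<integral>x. f x \<partial>lebesgue)"
      using set_int[of UNIV] by simp
    also have "(\<lambda>x. f x) = (\<lambda>x. indicator (box a b) x * f x)"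
      by (rule ext) (use supp in \<open>auto simp: indicator_def\<close>)
    finally show ?thesis using boxes by simp
  qed
  let ?G = "range (\<lambda>(c, d). box c d :: 'a set)"
  have G: "sets borel = sigma_sets UNIV ?G"
    by (simp add: borel_eq_box)
  have set_intable: "set_integrable lborel A g" if "A \<in> sets borel" for A
    unfolding set_integrable_def using int_g that by (intro integrable_mult_indicator) auto
  have "(LINT x:A|lborel. g x) = 0" if "A \<in> sigma_sets UNIV ?G" for A
  proof (rule sigma_sets_induct_disjoint[OF _ _ that])
    show "Int_stable ?G"
      by (auto simp: Int_stable_def box_Int_box)
    show "(LINT x:A|lborel. g x) = 0" if "A \<in> ?G" for A
      using that boxes set_int by fastforce
    show "(LINT x:UNIV - A|lborel. g x) = 0"
      if "A \<in> sigma_sets UNIV ?G" "(LINT x:A|lborel. g x) = 0" for A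
    proof -
      have "A \<in> sets borel" using that G by simp
      then have "(LINT x:A \<union> (UNIV - A)|lborel. g x) = (LINT x:A|lborel. g x) + (LINT x:UNIV - A|lborel. g x)"
        by (intro set_integral_Un set_intable) auto
      then show ?thesis using total that by simp
    qed
    show "(LINT x:(\<Union>i. A i)|lborel. g x) = 0"
      if "disjoint_family A" "range A \<subseteq> sigma_sets UNIV ?G" "\<And>i. (LINT x:A i|lborel. g x) = 0" for A :: "nat \<Rightarrow> 'a set"
    proof -
      have A: "A i \<in> sets borel" for i using that(2) G by auto
      then have "(LINT x:(\<Union>i. A i)|lborel. g x) = (\<Sum>i. (LINT x:A i|lborel. g x))"
        using that(1)
        by (intro lebesgue_integral_countable_add set_intable)
          (auto simp: disjoint_family_on_def)
      then show ?thesis using that(3) by simp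
    qed
  qed (auto simp: set_lebesgue_integral_def)
  then have "AE x in lborel. g x = 0"
    using G by (intro sigma_finite_measure.density_zero[OF lborel.sigma_finite_measure_axioms int_g]) simp
  with fg have "AE x in lborel. f x = 0" by eventually_elim simp
  then show ?thesis by (rule AE_completion)
qed

text \<open>Dominated convergence: the cutoffs lie in [0, 1] and tend to the indicator of the open
  box, so |f| on the closed box is a majorant. \<open>f\<close> is integrable only there, hence the
  indicator in \<open>?f\<close>.\<close>

lemma box_cutoff_integral_tendsto:
  fixes f :: "real^3 \<Rightarrow> real"
  assumes U: "U \<in> sets lebesgue" "cbox a b \<subseteq> U"
    and f: "integrable (lebesgue_on (cbox a b)) f"
  shows "(\<lambda>n. \<integral>x. f x * box_cutoff a b n x \<partial>lebesgue_on U)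
    \<longlonglongrightarrow> (\<integral>x. indicator (box a b) x * f x \<partial>lebesgue)"
proof -
  let ?f = "\<lambda>x. indicat_real (cbox a b) x * f x"
  have int: "integrable lebesgue ?f"
    using f by (simp add: integrable_restrict_space)
  have cutoff: "box_cutoff a b n \<in> borel_measurable lebesgue" for n
  proof -
    have "continuous_on UNIV (box_cutoff a b n)"
      using smooth_box_cutoff[of a b n] unfolding smooth_def by (metis Ck.simps(1))
    then have "box_cutoff a b n \<in> borel_measurable lborel"
      using borel_measurable_continuous_onI by auto
    then show ?thesis by (rule measurable_completion)
  qed
  have "(\<lambda>n. \<integral>x. ?f x * box_cutoff a b n x \<partial>lebesgue) \<longlonglongrightarrow> (\<integral>x. ?f x * indicator (box a b) x \<partial>lebesgue)"
  proof (rule integral_dominated_convergence[where w = "\<lambda>x. norm (?f x)"])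
    show "AE x in lebesgue. (\<lambda>n. ?f x * box_cutoff a b n x) \<longlonglongrightarrow> ?f x * indicator (box a b) x"
      by (intro AE_I2 tendsto_mult tendsto_const box_cutoff_tendsto)
    show "AE x in lebesgue. norm (?f x * box_cutoff a b n x) \<le> norm (?f x)" for n
      unfolding real_norm_def abs_mult[of _ "box_cutoff a b n _"] abs_of_nonneg[OF box_cutoff_bounds(1)]
      by (intro AE_I2 mult_left_le box_cutoff_bounds abs_ge_zero)
    show "(\<lambda>x. ?f x * box_cutoff a b n x) \<in> borel_measurable lebesgue" for n
      using borel_measurable_times[OF borel_measurable_integrable[OF int] cutoff] .
    show "(\<lambda>x. ?f x * indicator (box a b) x) \<in> borel_measurable lebesgue"
      by (rule borel_measurable_times[OF borel_measurable_integrable[OF int] borel_measurable_indicator]) simp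
  qed (rule integrable_norm[OF int])
  moreover have "(\<integral>x. ?f x * box_cutoff a b n x \<partial>lebesgue) = (\<integral>x. f x * box_cutoff a b n x \<partial>lebesgue_on U)" for n
  proof -
    have "?f x * box_cutoff a b n x = indicator U x *\<^sub>R (f x * box_cutoff a b n x)" for x
      using U(2) box_subset_cbox[of a b] box_cutoff_eq_0[of x a b n]
      by (auto simp: indicator_def split: if_splits)
    then have "(\<lambda>x. ?f x * box_cutoff a b n x) = (\<lambda>x. indicator U x *\<^sub>R (f x * box_cutoff a b n x))"
      by (rule ext)
    moreover have "U \<inter> space lebesgue \<in> sets lebesgue"
      using U(1) by simp
    ultimately show ?thesis by (simp only: integral_restrict_space)
  qed
  moreover have "(\<lambda>x. ?f x * indicator (box a b) x) = (\<lambda>x. indicator (box a b) x * f x)"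
    by (rule ext) (use box_subset_cbox[of a b] in \<open>auto simp: indicator_def\<close>)
  ultimately show ?thesis by (simp only:)
qed

text \<open>Testing with the cutoffs and passing to the limit equates the integrals of
  \<open>f1\<close> and \<open>f2\<close> over every box whose closed box lies in \<open>U\<close>.
  The difference, restricted to \<open>box a b\<close>, then has vanishing integrals over all
  boxes.\<close>

lemma fundamental_lemma_calculus_of_variations_cbox:
  fixes f1 f2 :: "real^3 \<Rightarrow> real"
  assumes "U \<in> sets lebesgue" and K: "cbox a b \<subseteq> U"
    and f1: "locally_integrable U f1" and f2: "locally_integrable U f2"
    and eq: "\<And>\<phi>. test_function U \<phi> \<Longrightarrow>
      (\<integral>x. f1 x * \<phi> x \<partial>lebesgue_on U) = (\<integral>x. f2 x * \<phi> x \<partial>lebesgue_on U)"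
  shows "AE x in lebesgue. x \<in> cbox a b \<longrightarrow> f1 x = f2 x"
proof -
  let ?f = "\<lambda>x. indicator (box a b) x * (f1 x - f2 x)"
  have int12: "integrable (lebesgue_on (cbox c d)) f1" "integrable (lebesgue_on (cbox c d)) f2"
    if "cbox c d \<subseteq> U" for c d
    using f1 f2 that by (auto simp: locally_integrable_def)
  have eq_box: "(\<integral>x. indicator (box c d) x * f1 x \<partial>lebesgue) = (\<integral>x. indicator (box c d) x * f2 x \<partial>lebesgue)"
    if "cbox c d \<subseteq> U" for c d
    using box_cutoff_integral_tendsto[OF assms(1) that int12(1)[OF that]]
      box_cutoff_integral_tendsto[OF assms(1) that int12(2)[OF that]]
      eq[OF test_function_box_cutoff[OF that]]
    by (simp add: LIMSEQ_unique)
  have int_box: "integrable lebesgue (\<lambda>x. indicator (box c d) x * f1 x)"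
      "integrable lebesgue (\<lambda>x. indicator (box c d) x * f2 x)"
    if "cbox c d \<subseteq> U" for c d
  proof -
    have "integrable lebesgue (\<lambda>x. indicator (box c d) x * (indicator (cbox c d) x * f x))"
      if "integrable (lebesgue_on (cbox c d)) f" for f :: "real^3 \<Rightarrow> real"
      using integrable_mult_indicator[of "box c d" lebesgue "\<lambda>x. indicator (cbox c d) x * f x"] that
      by (simp add: integrable_restrict_space)
    moreover have "indicator (box c d) x * (indicator (cbox c d) x * r) = indicator (box c d) x * r"
      for x :: "real^3" and r :: real
      using box_subset_cbox[of c d] by (auto simp: indicator_def)
    ultimately show "integrable lebesgue (\<lambda>x. indicator (box c d) x * f1 x)"
      "integrable lebesgue (\<lambda>x. indicator (box c d) x * f2 x)"
      using int12[OF that] by simp_all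
  qed
  have "AE x in lebesgue. ?f x = 0"
  proof (rule AE_eq_0_if_box_integrals_eq_0)
    show "integrable lebesgue ?f"
      using int_box[OF K] by (simp add: right_diff_distrib)
    show "?f x = 0" if "x \<notin> box a b" for x
      using that by simp
    show "(\<integral>x. indicator (box c d) x * ?f x \<partial>lebesgue) = 0" for c d
    proof -
      obtain c' d' where cd: "box c d \<inter> box a b = box c' d'"
        by (rule that[OF box_Int_box])
      show ?thesis
      \<comment> \<open>For an empty open box, \<open>cbox c' d'\<close> may still be nonempty and
        leave \<open>U\<close>. In the other case it is the closure of \<open>box c' d'\<close> and
        stays in \<open>cbox a b\<close>.\<close>
      proof (cases "box c' d' = {}")
        case True
        have "(\<lambda>x. indicator (box c d) x * ?f x) = (\<lambda>_. 0)"
          by (rule ext) (use cd True in \<open>auto simp: indicator_def\<close>)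
        then show ?thesis by (simp only: Bochner_Integration.integral_zero)
      next
        case False
        have "box c' d' \<subseteq> cbox a b"
          using cd box_subset_cbox[of a b] by blast
        then have "cbox c' d' \<subseteq> cbox a b"
          using False closure_box[OF False] closure_minimal[OF _ closed_cbox, of "box c' d'" a b] by simp
        then have sub: "cbox c' d' \<subseteq> U" using K by blast
        have "(\<lambda>x. indicator (box c d) x * ?f x)
            = (\<lambda>x. indicator (box c' d') x * f1 x - indicator (box c' d') x * f2 x)"
          by (simp flip: cd add: indicator_inter_arith right_diff_distrib mult.assoc)
        then show ?thesis
          using int_box[OF sub] eq_box[OF sub] by simp
      qed
    qed
  qed
  \<comment> \<open>So far equality is known on the open box; the faces form a null set.\<close>
  moreover have "AE x in lebesgue. x \<notin> cbox a b - box a b"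
    using negligible_frontier_interval[of a b]
    unfolding negligible_iff_null_sets by (rule AE_not_in)
  ultimately show ?thesis
    by eventually_elim (auto simp: indicator_def)
qed

text \<open>An open set is a countable union of closed boxes, and the countably many exceptional
  null sets can be joined.\<close>

lemma fundamental_lemma_calculus_of_variations:
  fixes f1 f2 :: "real^3 \<Rightarrow> real"
  assumes U: "open U"
    and f: "locally_integrable U f1" "locally_integrable U f2"
    and eq: "\<And>\<phi>. test_function U \<phi> \<Longrightarrow>
      (\<integral>x. f1 x * \<phi> x \<partial>lebesgue_on U) = (\<integral>x. f2 x * \<phi> x \<partial>lebesgue_on U)"
  shows "AE x in lebesgue_on U. f1 x = f2 x"
proof -
  obtain \<C> where \<C>: "countable \<C>" "\<C> \<subseteq> Pow U" "\<And>X. X \<in> \<C> \<Longrightarrow> \<exists>a b. X = cbox a b" "\<Union>\<C> = U"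
    using open_countable_Union_open_cbox[OF U] by blast
  have "AE x in lebesgue. \<forall>X\<in>\<C>. x \<in> X \<longrightarrow> f1 x = f2 x"
    unfolding AE_ball_countable[OF \<C>(1)]
  proof
    fix X assume "X \<in> \<C>"
    then obtain a b where "X = cbox a b" "cbox a b \<subseteq> U" using \<C> by blast
    then show "AE x in lebesgue. x \<in> X \<longrightarrow> f1 x = f2 x"
      using fundamental_lemma_calculus_of_variations_cbox[OF _ _ f eq] U by auto
  qed
  then have "AE x in lebesgue. x \<in> U \<longrightarrow> f1 x = f2 x"
    by eventually_elim (use \<C>(4) in blast)
  then show ?thesis using U by (simp add: AE_restrict_space_iff)
qed

text \<open>Measurability can be checked on a countable cover by closed boxes, where it is part of
  integrability. It supplies the measurability of weak gradients on all of \<open>U\<close> when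
  their norms are compared.\<close>

lemma locally_integrable_borel_measurable:
  fixes f :: "real^3 \<Rightarrow> 'b::euclidean_space"
  assumes U: "open U" and f: "locally_integrable U f"
  shows "f \<in> borel_measurable (lebesgue_on U)"
proof -
  obtain \<C> where \<C>: "countable \<C>" "\<C> \<subseteq> Pow U" "\<And>X. X \<in> \<C> \<Longrightarrow> \<exists>a b. X = cbox a b" "\<Union>\<C> = U"
    using open_countable_Union_open_cbox[OF U] by blast
  show ?thesis
  proof (rule measurable_piecewise_restrict[OF \<C>(1)])
    show "\<Omega> \<inter> space (lebesgue_on U) \<in> sets (lebesgue_on U)" if "\<Omega> \<in> \<C>" for \<Omega>
      using that \<C>(2,3) U by (fastforce simp: sets_restrict_space_iff)
    show "space (lebesgue_on U) \<subseteq> \<Union>\<C>"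
      using \<C>(4) by simp
    show "f \<in> measurable (restrict_space (lebesgue_on U) \<Omega>) borel" if "\<Omega> \<in> \<C>" for \<Omega>
    proof -
      obtain a b where ab: "\<Omega> = cbox a b" "\<Omega> \<subseteq> U" using \<C>(2,3) \<open>\<Omega> \<in> \<C>\<close> by blast
      then have "integrable (lebesgue_on \<Omega>) f"
        using f by (auto simp: locally_integrable_def)
      moreover have "restrict_space (lebesgue_on U) \<Omega> = lebesgue_on \<Omega>"
        using ab U by (simp add: restrict_restrict_space Int_absorb1)
      ultimately show ?thesis by (simp add: borel_measurable_integrable)
    qed
  qed
qed

text \<open>Entry by entry, both gradients have the same integral against any test function, namely
  minus that of \<open>v\<close> against the partial derivative.\<close>

lemma has_weak_grad_unique:
  assumes U: "open U" and G: "has_weak_grad U v G1" "has_weak_grad U v G2"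
  shows "AE x in lebesgue_on U. G1 x = G2 x"
proof -
  have comp: "locally_integrable U (\<lambda>x. G x $ i $ j)" if "has_weak_grad U v G" for G i j
    unfolding locally_integrable_def
  proof (intro allI impI)
    fix K assume "compact K \<and> K \<subseteq> U"
    then have "integrable (lebesgue_on K) G"
      using that by (simp add: has_weak_grad_def locally_integrable_def)
    then show "integrable (lebesgue_on K) (\<lambda>x. G x $ i $ j)"
      by (intro integrable_bounded_linear[OF bounded_linear_vec_nth])
  qed
  have "AE x in lebesgue_on U. G1 x $ i $ j = G2 x $ i $ j" for i j
  proof (rule fundamental_lemma_calculus_of_variations[OF U comp[OF G(1)] comp[OF G(2)]])
    fix \<phi> assume "test_function U \<phi>"
    then have "- (\<integral>x. G x $ i $ j * \<phi> x \<partial>lebesgue_on U) = (\<integral>x. v x $ i * partial_deriv j \<phi> x \<partial>lebesgue_on U)"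
      if "has_weak_grad U v G" for G
      using that by (simp add: has_weak_grad_def)
    from this[OF G(1)] this[OF G(2)] show "(\<integral>x. G1 x $ i $ j * \<phi> x \<partial>lebesgue_on U) = (\<integral>x. G2 x $ i $ j * \<phi> x \<partial>lebesgue_on U)"
      by linarith
  qed
  then have "AE x in lebesgue_on U. \<forall>i j. G1 x $ i $ j = G2 x $ i $ j"
    by (simp add: AE_all_countable)
  then show ?thesis by eventually_elim (simp add: vec_eq_iff)
qed

section \<open>Norms independent of the chosen weak gradient\<close>

lemma L2_norm_nonneg: "0 \<le> L2_norm U f"
  by (simp add: L2_norm_def)

text \<open>The chosen \<open>weak_grad\<close> agrees with a known weak gradient only almost
  everywhere, which is enough for the norm. Every computation with \<open>weak_grad\<close> below
  goes through this.\<close>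

lemma L2_norm_weak_grad:
  assumes U: "open U" and G: "has_weak_grad U v G"
  shows "L2_norm U (weak_grad U v) = L2_norm U G"
proof -
  have W: "has_weak_grad U v (weak_grad U v)"
    unfolding weak_grad_def by (rule someI[of "has_weak_grad U v", OF G])
  have meas: "F \<in> borel_measurable (lebesgue_on U)" if "has_weak_grad U v F" for F
    using that by (intro locally_integrable_borel_measurable[OF U]) (simp add: has_weak_grad_def)
  have "(\<integral>x. (norm (weak_grad U v x))\<^sup>2 \<partial>lebesgue_on U) = (\<integral>x. (norm (G x))\<^sup>2 \<partial>lebesgue_on U)"
    using has_weak_grad_unique[OF U W G] meas[OF W] meas[OF G]
    by (intro integral_cong_AE) auto
  then show ?thesis by (simp add: L2_norm_def)
qed

lemma H1_norm_zero:
  assumes "open U"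
  shows "H1_norm U (\<lambda>_. 0) = 0"
proof -
  have "has_weak_grad U (\<lambda>_. 0) (\<lambda>_. 0)"
    by (simp add: has_weak_grad_def locally_integrable_def)
  from L2_norm_weak_grad[OF assms this] show ?thesis
    by (simp add: H1_norm_def L2_norm_def)
qed

lemma has_weak_grad_minus:
  assumes "has_weak_grad U v G"
  shows "has_weak_grad U (\<lambda>x. - v x) (\<lambda>x. - G x)"
  using assms by (simp add: has_weak_grad_def locally_integrable_def)

text \<open>The weak gradients of \<open>v\<close> and of its negative are chosen independently, so
  they are compared by their norms. The sign of the discrete test function is handled by
  this.\<close>

lemma H1_norm_minus:
  assumes "open U" "v \<in> H1_space U"
  shows "H1_norm U (\<lambda>x. - v x) = H1_norm U v"
proof -
  obtain G where "has_weak_grad U v G"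
    using assms(2) by (auto simp: H1_space_def)
  then have "L2_norm U (weak_grad U (\<lambda>x. - v x)) = L2_norm U (weak_grad U v)"
    using L2_norm_weak_grad[OF assms(1)] L2_norm_weak_grad[OF assms(1) has_weak_grad_minus]
    by (simp add: L2_norm_def)
  then show ?thesis
    by (simp add: H1_norm_def L2_norm_def)
qed

subsection \<open>Projection onto finite element spaces\<close>

lemma L2_space_add:
  assumes "f \<in> L2_space U" "g \<in> L2_space U"
  shows "(\<lambda>x. f x + g x) \<in> L2_space U"
proof -
  have meas: "f \<in> borel_measurable (lebesgue_on U)" "g \<in> borel_measurable (lebesgue_on U)"
    and int: "integrable (lebesgue_on U) (\<lambda>x. 2 * (norm (f x))\<^sup>2 + 2 * (norm (g x))\<^sup>2)"
    using assms by (auto simp: L2_space_def)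
  have "(norm (f x + g x))\<^sup>2 \<le> 2 * (norm (f x))\<^sup>2 + 2 * (norm (g x))\<^sup>2" for x
  proof -
    have "(norm (f x + g x))\<^sup>2 \<le> (norm (f x) + norm (g x))\<^sup>2"
      by (intro power_mono norm_triangle_ineq) simp
    also have "\<dots> \<le> 2 * (norm (f x))\<^sup>2 + 2 * (norm (g x))\<^sup>2"
      using zero_le_power2[of "norm (f x) - norm (g x)"] by (simp add: power2_eq_square algebra_simps)
    finally show ?thesis .
  qed
  then have "integrable (lebesgue_on U) (\<lambda>x. (norm (f x + g x))\<^sup>2)"
    using meas by (intro Bochner_Integration.integrable_bound[OF int]) auto
  then show ?thesis
    using meas by (simp add: L2_space_def)
qed

lemma L2_space_scaleR: "f \<in> L2_space U \<Longrightarrow> (\<lambda>x. c *\<^sub>R f x) \<in> L2_space U"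
  by (auto simp: L2_space_def power_mult_distrib)

lemma L2_space_minus: "f \<in> L2_space U \<Longrightarrow> g \<in> L2_space U \<Longrightarrow> (\<lambda>x. f x - g x) \<in> L2_space U"
  using L2_space_add[OF _ L2_space_scaleR[of g U "-1"], of f] by simp

lemma L2_inner_integrable:
  assumes "f \<in> L2_space U" "g \<in> L2_space U"
  shows "integrable (lebesgue_on U) (\<lambda>x. f x \<bullet> g x)"
proof -
  have meas: "f \<in> borel_measurable (lebesgue_on U)" "g \<in> borel_measurable (lebesgue_on U)"
    and int: "integrable (lebesgue_on U) (\<lambda>x. (norm (f x))\<^sup>2 + (norm (g x))\<^sup>2)"
    using assms by (auto simp: L2_space_def)
  have "\<bar>f x \<bullet> g x\<bar> \<le> (norm (f x))\<^sup>2 + (norm (g x))\<^sup>2" for x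
  proof -
    have "\<bar>f x \<bullet> g x\<bar> \<le> norm (f x) * norm (g x)"
      by (rule Cauchy_Schwarz_ineq2)
    also have "\<dots> \<le> 2 * (norm (f x) * norm (g x))" by simp
    also have "\<dots> \<le> (norm (f x))\<^sup>2 + (norm (g x))\<^sup>2"
      using sum_squares_bound[of "norm (f x)" "norm (g x)"] by simp
    finally show ?thesis .
  qed
  then show ?thesis
    using meas by (intro Bochner_Integration.integrable_bound[OF int]) auto
qed

lemma L2_inner_commute: "L2_inner U f g = L2_inner U g f"
  by (simp add: L2_inner_def inner_commute)

lemma L2_inner_scaleR_left: "L2_inner U (\<lambda>x. c *\<^sub>R f x) g = c * L2_inner U f g"
  by (simp add: L2_inner_def)

lemma L2_inner_add_left:
  assumes "f \<in> L2_space U" "g \<in> L2_space U" "h \<in> L2_space U"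
  shows "L2_inner U (\<lambda>x. f x + g x) h = L2_inner U f h + L2_inner U g h"
  using assms by (simp add: L2_inner_def inner_add_left L2_inner_integrable)

lemma L2_inner_diff_left:
  assumes "f \<in> L2_space U" "g \<in> L2_space U" "h \<in> L2_space U"
  shows "L2_inner U (\<lambda>x. f x - g x) h = L2_inner U f h - L2_inner U g h"
  using assms by (simp add: L2_inner_def inner_diff_left L2_inner_integrable)

lemma L2_inner_scaleR_right: "L2_inner U g (\<lambda>x. c *\<^sub>R f x) = c * L2_inner U g f"
  by (simp add: L2_inner_def)

lemma L2_inner_add_right:
  assumes "f \<in> L2_space U" "g \<in> L2_space U" "h \<in> L2_space U"
  shows "L2_inner U h (\<lambda>x. f x + g x) = L2_inner U h f + L2_inner U h g"
  using L2_inner_add_left[OF assms] by (simp add: L2_inner_commute)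

lemma L2_inner_self: "L2_inner U f f = (L2_norm U f)\<^sup>2"
  by (simp add: L2_inner_def L2_norm_def power2_norm_eq_inner)

lemma L2_norm_eq_0_iff:
  assumes "f \<in> L2_space U"
  shows "L2_norm U f = 0 \<longleftrightarrow> ae_zero U f"
  using assms integral_nonneg_eq_0_iff_AE[of "lebesgue_on U" "\<lambda>x. (norm (f x))\<^sup>2"]
  by (simp add: L2_norm_def ae_zero_def L2_space_def)

lemma L2_inner_ae_zero: "ae_zero U g \<Longrightarrow> L2_inner U f g = 0"
  unfolding L2_inner_def ae_zero_def by (rule integral_eq_zero_AE) (auto elim: eventually_mono)

text \<open>The squared norm of \<open>f\<close> minus its projection \<open>t *\<^sub>R g\<close>
  onto the line of \<open>g\<close> is nonnegative. The form is only semidefinite, so a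
  \<open>g\<close> of norm zero is treated apart.\<close>

lemma L2_Cauchy_Schwarz:
  assumes f: "f \<in> L2_space U" and g: "g \<in> L2_space U"
  shows "\<bar>L2_inner U f g\<bar> \<le> L2_norm U f * L2_norm U g"
proof (cases "ae_zero U g")
  case True
  then show ?thesis by (simp add: L2_inner_ae_zero L2_norm_nonneg)
next
  case False
  let ?a = "L2_inner U f f" and ?b = "L2_inner U f g" and ?c = "L2_inner U g g"
  have c: "0 < ?c"
    using False L2_norm_eq_0_iff[OF g] by (simp add: L2_inner_self)
  define t where "t = ?b / ?c"
  have tg: "(\<lambda>x. t *\<^sub>R g x) \<in> L2_space U"
    by (rule L2_space_scaleR[OF g])
  have d: "(\<lambda>x. f x - t *\<^sub>R g x) \<in> L2_space U"
    by (rule L2_space_minus[OF f tg])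
  have "0 \<le> L2_inner U (\<lambda>x. f x - t *\<^sub>R g x) (\<lambda>x. f x - t *\<^sub>R g x)"
    by (simp add: L2_inner_self)
  also have "\<dots> = L2_inner U f (\<lambda>x. f x - t *\<^sub>R g x) - t * L2_inner U g (\<lambda>x. f x - t *\<^sub>R g x)"
    by (simp add: L2_inner_diff_left[OF f tg d] L2_inner_scaleR_left)
  also have "\<dots> = L2_inner U (\<lambda>x. f x - t *\<^sub>R g x) f - t * L2_inner U (\<lambda>x. f x - t *\<^sub>R g x) g"
    by (simp only: L2_inner_commute)
  also have "\<dots> = (?a - t * ?b) - t * (?b - t * ?c)"
    by (simp add: L2_inner_diff_left[OF f tg f] L2_inner_diff_left[OF f tg g] L2_inner_scaleR_left
        L2_inner_commute[of U g f])
  also have "\<dots> = ?a - ?b\<^sup>2 / ?c"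
    using c by (simp add: t_def power2_eq_square)
  finally have "?b\<^sup>2 \<le> ?a * ?c"
    using c by (simp add: field_simps)
  then have "\<bar>?b\<bar>\<^sup>2 \<le> (L2_norm U f * L2_norm U g)\<^sup>2"
    by (simp add: L2_inner_self power_mult_distrib)
  then show ?thesis
    by (rule power2_le_imp_le) (simp add: L2_norm_nonneg)
qed

text \<open>Induction on the spanning family: members of \<open>X\<close> that do not need the function of index \<open>k\<close> form a
  subspace of codimension at most one, to which one Gram-Schmidt step is added.\<close>

lemma L2_projection_exists:
  fixes \<beta> :: "'i \<Rightarrow> real^3 \<Rightarrow> real^3"
  assumes "finite I" "linear_function_space X" "X \<subseteq> L2_space U"
    and "\<forall>v\<in>X. \<exists>c. AE x in lebesgue_on U. v x = (\<Sum>i\<in>I. c i *\<^sub>R \<beta> i x)"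
    and "w \<in> L2_space U"
  shows "\<exists>p\<in>X. \<forall>q\<in>X. L2_inner U (\<lambda>x. w x - p x) q = 0"
  using assms
proof (induction I arbitrary: X w rule: finite_induct)
  case empty
  have "(\<lambda>_. 0) \<in> X"
    using empty.prems(1) by (simp add: linear_function_space_def)
  moreover have "ae_zero U q" if "q \<in> X" for q
    using empty.prems(3) that by (auto simp: ae_zero_def)
  ultimately show ?case
    by (auto simp: L2_inner_ae_zero)
next
  case (insert k I)
  note lin = insert.prems(1)[unfolded linear_function_space_def]
  have X_add: "(\<lambda>x. u x + v x) \<in> X" if "u \<in> X" "v \<in> X" for u v using lin that by blast
  have X_scale: "(\<lambda>x. c *\<^sub>R v x) \<in> X" if "v \<in> X" for c v using lin that by blast
  define X' where "X' = {v \<in> X. \<exists>c. AE x in lebesgue_on U. v x = (\<Sum>i\<in>I. c i *\<^sub>R \<beta> i x)}"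
  have X'X: "X' \<subseteq> X" by (auto simp: X'_def)
  have X'_scale: "(\<lambda>x. t *\<^sub>R v x) \<in> X'" if v: "v \<in> X'" for t v
  proof -
    obtain c where c: "AE x in lebesgue_on U. v x = (\<Sum>i\<in>I. c i *\<^sub>R \<beta> i x)"
      using v by (auto simp: X'_def)
    have "AE x in lebesgue_on U. t *\<^sub>R v x = (\<Sum>i\<in>I. (t * c i) *\<^sub>R \<beta> i x)"
      using c by eventually_elim (simp add: scaleR_sum_right)
    then show ?thesis using v by (auto simp: X'_def intro!: X_scale)
  qed
  have X'_add: "(\<lambda>x. u x + v x) \<in> X'" if u: "u \<in> X'" and v: "v \<in> X'" for u v
  proof -
    obtain c d where c: "AE x in lebesgue_on U. u x = (\<Sum>i\<in>I. c i *\<^sub>R \<beta> i x)"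
      and d: "AE x in lebesgue_on U. v x = (\<Sum>i\<in>I. d i *\<^sub>R \<beta> i x)"
      using u v by (auto simp: X'_def)
    have "AE x in lebesgue_on U. u x + v x = (\<Sum>i\<in>I. (c i + d i) *\<^sub>R \<beta> i x)"
      using c d by eventually_elim (simp add: scaleR_add_left sum.distrib)
    then show ?thesis using u v by (auto simp: X'_def intro!: X_add)
  qed
  have "(\<lambda>_. 0) \<in> X'"
    using lin by (auto simp: X'_def intro!: exI[of _ "\<lambda>_. 0"])
  then have X'_lin: "linear_function_space X'"
    using X'_add X'_scale by (auto simp: linear_function_space_def)
  have X'_L2: "X' \<subseteq> L2_space U" using X'X insert.prems(2) by blast
  have IH: "\<exists>p\<in>X'. \<forall>q\<in>X'. L2_inner U (\<lambda>x. w x - p x) q = 0" if "w \<in> L2_space U" for w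
    by (rule insert.IH[OF X'_lin X'_L2 _ that]) (auto simp: X'_def)
  show ?case
  proof (cases "X' = X")
    case True
    then show ?thesis using IH[OF insert.prems(4)] by simp
  next
    case False
    then obtain u where u: "u \<in> X" "u \<notin> X'" using X'X by blast
    obtain cu where cu: "AE x in lebesgue_on U. u x = (\<Sum>i\<in>insert k I. cu i *\<^sub>R \<beta> i x)"
      using insert.prems(3) u(1) by blast
    \<comment> \<open>Otherwise the expansion of \<open>u\<close> would avoid the index
      \<open>k\<close> and put \<open>u\<close> into \<open>X'\<close>.\<close>
    have "cu k \<noteq> 0"
      using cu u insert.hyps by (auto simp: X'_def)
    \<comment> \<open>\<open>X\<close> is \<open>X'\<close> plus the line of \<open>u\<close>: a
      suitable multiple of \<open>u\<close> cancels the coefficient of index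
      \<open>k\<close>.\<close>
    have reduce: "\<exists>t. (\<lambda>x. q x + t *\<^sub>R u x) \<in> X'" if q: "q \<in> X" for q
    proof -
      obtain c where c: "AE x in lebesgue_on U. q x = (\<Sum>i\<in>insert k I. c i *\<^sub>R \<beta> i x)"
        using insert.prems(3) q by blast
      define t where "t = - c k / cu k"
      have "c k + t * cu k = 0" using \<open>cu k \<noteq> 0\<close> by (simp add: t_def)
      then have k0: "c k *\<^sub>R y + t *\<^sub>R cu k *\<^sub>R y = 0" for y :: "real^3"
        by (metis scaleR_add_left scaleR_scaleR scaleR_zero_left)
      have "AE x in lebesgue_on U. q x + t *\<^sub>R u x = (\<Sum>i\<in>I. (c i + t * cu i) *\<^sub>R \<beta> i x)"
        using c cu
      proof eventually_elim
        case (elim x)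
        then have "q x + t *\<^sub>R u x = (c k *\<^sub>R \<beta> k x + t *\<^sub>R cu k *\<^sub>R \<beta> k x)
            + ((\<Sum>i\<in>I. c i *\<^sub>R \<beta> i x) + t *\<^sub>R (\<Sum>i\<in>I. cu i *\<^sub>R \<beta> i x))"
          using insert.hyps by (simp add: scaleR_add_right)
        then show ?case
          by (simp only: k0) (simp add: scaleR_add_left sum.distrib scaleR_sum_right)
      qed
      moreover have "(\<lambda>x. q x + t *\<^sub>R u x) \<in> X"
        using q u by (intro X_add X_scale)
      ultimately have "(\<lambda>x. q x + t *\<^sub>R u x) \<in> X'"
        by (auto simp: X'_def)
      then show ?thesis by blast
    qed
    have uL2: "u \<in> L2_space U" using u insert.prems(2) by blast
    then obtain pu where pu: "pu \<in> X'" "\<And>q. q \<in> X' \<Longrightarrow> L2_inner U (\<lambda>x. u x - pu x) q = 0"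
      using IH by blast
    \<comment> \<open>Gram-Schmidt: \<open>e\<close> is \<open>u\<close> made orthogonal to
      \<open>X'\<close>, and the projection onto \<open>X\<close> will be \<open>p'\<close> plus the
      component of \<open>w\<close> along \<open>e\<close>.\<close>
    define e where "e = (\<lambda>x. u x - pu x)"
    have eX: "e \<in> X"
      using X_add[OF u(1) X_scale[of pu "-1"]] pu(1) X'X by (auto simp: e_def)
    then have eL2: "e \<in> L2_space U" using insert.prems(2) by blast
    have e_orth: "L2_inner U e q = 0" if "q \<in> X'" for q
      using pu(2)[OF that] by (simp add: e_def)
    note wL2 = insert.prems(4)
    obtain p' where p': "p' \<in> X'" "\<And>q. q \<in> X' \<Longrightarrow> L2_inner U (\<lambda>x. w x - p' x) q = 0"
      using IH[OF wL2] by blast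
    have p'L2: "p' \<in> L2_space U" using p' X'_L2 by blast
    define s where "s = L2_inner U w e / L2_inner U e e"
    \<comment> \<open>If \<open>e\<close> has norm zero, the division gives the default 0, and the
      equation holds because both inner products vanish.\<close>
    have s: "s * L2_inner U e e = L2_inner U w e"
    proof (cases "L2_inner U e e = 0")
      case True
      then have "ae_zero U e" using L2_norm_eq_0_iff[OF eL2] by (simp add: L2_inner_self)
      then show ?thesis by (simp add: L2_inner_ae_zero)
    qed (simp add: s_def)
    have seL2: "(\<lambda>x. s *\<^sub>R e x) \<in> L2_space U" by (rule L2_space_scaleR[OF eL2])
    have wpL2: "(\<lambda>x. w x - p' x) \<in> L2_space U" by (rule L2_space_minus[OF wL2 p'L2])
    have split: "L2_inner U (\<lambda>x. w x - (p' x + s *\<^sub>R e x)) q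
        = L2_inner U (\<lambda>x. w x - p' x) q - s * L2_inner U e q" if "q \<in> L2_space U" for q
      using L2_inner_diff_left[OF wpL2 seL2 that] by (simp add: L2_inner_scaleR_left diff_diff_eq)
    have pL2: "(\<lambda>x. w x - (p' x + s *\<^sub>R e x)) \<in> L2_space U"
      using L2_space_minus[OF wpL2 seL2] by (simp add: diff_diff_eq)
    show ?thesis
    proof (intro bexI ballI)
      show "(\<lambda>x. p' x + s *\<^sub>R e x) \<in> X"
        using p'(1) X'X eX by (intro X_add X_scale) auto
    next
      fix q assume "q \<in> X"
      then obtain t where t: "(\<lambda>x. q x + t *\<^sub>R u x) \<in> X'" using reduce by blast
      \<comment> \<open>Replacing \<open>u\<close> by \<open>e + pu\<close> writes \<open>q\<close>
        as \<open>r\<close> in \<open>X'\<close> minus \<open>t\<close> times \<open>e\<close>, so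
        orthogonality to \<open>X'\<close> and to \<open>e\<close> suffices.\<close>
      define r where "r = (\<lambda>x. (q x + t *\<^sub>R u x) + (- t) *\<^sub>R pu x)"
      have r: "r \<in> X'"
        unfolding r_def by (rule X'_add[OF t X'_scale[OF pu(1)]])
      then have rL2: "r \<in> L2_space U" using X'_L2 by blast
      have q_eq: "q = (\<lambda>x. r x + (- t) *\<^sub>R e x)"
        by (auto simp: r_def e_def algebra_simps)
      have "L2_inner U (\<lambda>x. w x - (p' x + s *\<^sub>R e x)) r = 0"
        using split[OF rL2] p'(2)[OF r] e_orth[OF r] by simp
      moreover have "L2_inner U (\<lambda>x. w x - (p' x + s *\<^sub>R e x)) e = 0"
        using split[OF eL2] L2_inner_diff_left[OF wL2 p'L2 eL2] e_orth[OF p'(1)] s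
        by (simp add: L2_inner_commute[of U p' e])
      ultimately show "L2_inner U (\<lambda>x. w x - (p' x + s *\<^sub>R e x)) q = 0"
        unfolding q_eq L2_inner_add_right[OF rL2 L2_space_scaleR[OF eL2] pL2] L2_inner_scaleR_right
        by simp
    qed
  qed
qed

text \<open>A cell is the continuous image of a polytope. Compactness serves to make cells
  measurable.\<close>

lemma compact_cell:
  assumes "wf_fin_elem e"
  shows "compact (cell e)"
proof -
  obtain N J where "ref_cell e \<subseteq> N"
    "\<forall>x\<in>N. (chart e has_derivative (\<lambda>h. (J x :: real^3^3) *v h)) (at x)"
    using assms unfolding wf_fin_elem_def by (elim conjE exE) (rule that)
  then have "continuous_on (ref_cell e) (chart e)"
    by (meson continuous_at_imp_continuous_on has_derivative_continuous subsetD)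
  moreover have "compact (ref_cell e)"
    using assms by (simp add: wf_fin_elem_def polytope_imp_compact)
  ultimately show ?thesis
    unfolding cell_def by (rule compact_continuous_image)
qed

text \<open>Cells may overlap in their boundaries; \<open>sel\<close> assigns each point to a single cell.\<close>

lemma fe_space_finite_span:
  assumes U: "open U" and mesh: "is_mesh U \<T>" and fe: "fe_space U \<T> Z X"
  shows "\<exists>I :: (fin_elem \<times> (real^3 \<Rightarrow> real^3)) set. \<exists>\<beta>. finite I \<and>
    (\<forall>v\<in>X. \<exists>c. AE x in lebesgue_on U. v x = (\<Sum>i\<in>I. c i *\<^sub>R \<beta> i x))"
proof -
  define sel where "sel x = (SOME e. e \<in> \<T> \<and> x \<in> cell e)" for x
  have sel: "sel x \<in> \<T>" "x \<in> cell (sel x)" if "x \<in> U" for x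
  proof -
    have "x \<in> closure U" using that closure_subset by blast
    also have "closure U = (\<Union>e\<in>\<T>. cell e)" using mesh by (simp add: is_mesh_def)
    finally have "\<exists>e. e \<in> \<T> \<and> x \<in> cell e" by blast
    from someI_ex[OF this] show "sel x \<in> \<T>" "x \<in> cell (sel x)"
      by (auto simp: sel_def)
  qed
  let ?I = "SIGMA e:\<T>. ref_basis e"
  \<comment> \<open>A shape function of \<open>e\<close>, cut off to the points assigned to
    \<open>e\<close>. Such discontinuous functions span members of \<open>X\<close> up to null sets
    without having to belong to \<open>X\<close>.\<close>
  define \<beta> :: "fin_elem \<times> (real^3 \<Rightarrow> real^3) \<Rightarrow> real^3 \<Rightarrow> real^3"
    where "\<beta> = (\<lambda>(e, b) x. if sel x = e then b (inv_into (ref_cell e) (chart e) x) else 0)"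
  have fin: "finite \<T>" "\<And>e. e \<in> \<T> \<Longrightarrow> finite (ref_basis e)"
    using mesh by (auto simp: is_mesh_def wf_fin_elem_def)
  have "\<exists>c. AE x in lebesgue_on U. v x = (\<Sum>i\<in>?I. c i *\<^sub>R \<beta> i x)" if v: "v \<in> X" for v
  proof -
    have "\<forall>e\<in>\<T>. \<exists>c. AE x in lebesgue_on (cell e \<inter> U).
        v x = (\<Sum>b\<in>ref_basis e. c b *\<^sub>R b (inv_into (ref_cell e) (chart e) x))"
    proof
      fix e assume e: "e \<in> \<T>"
      obtain p where p: "p \<in> shape_functions e" "AE x in lebesgue_on (cell e \<inter> U). v x = p x"
        using fe v e unfolding fe_space_def by blast
      from p(1) obtain c where
        "p = (\<lambda>y. \<Sum>b\<in>ref_basis e. c b *\<^sub>R b (inv_into (ref_cell e) (chart e) y))"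
        unfolding shape_functions_def by (rule rangeE)
      then show "\<exists>c. AE x in lebesgue_on (cell e \<inter> U).
        v x = (\<Sum>b\<in>ref_basis e. c b *\<^sub>R b (inv_into (ref_cell e) (chart e) x))"
        using p(2) by (intro exI[of _ c]) simp
    qed
    from bchoice[OF this] obtain c where c: "\<forall>e\<in>\<T>. AE x in lebesgue_on (cell e \<inter> U).
        v x = (\<Sum>b\<in>ref_basis e. c e b *\<^sub>R b (inv_into (ref_cell e) (chart e) x))"
      by (rule exE)
    \<comment> \<open>Turning the restricted measure into an implication on \<open>U\<close> lets
      the finitely many exceptional sets be joined.\<close>
    have "AE x in lebesgue_on U. x \<in> cell e \<longrightarrow>
        v x = (\<Sum>b\<in>ref_basis e. c e b *\<^sub>R b (inv_into (ref_cell e) (chart e) x))" if "e \<in> \<T>" for e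
    proof -
      have "compact (cell e)"
        using compact_cell mesh that by (simp add: is_mesh_def)
      then have "cell e \<in> sets lebesgue"
        by (simp add: borel_compact sets_completionI_sets)
      then have "cell e \<inter> U \<in> sets lebesgue" using U by auto
      then have "AE x in lebesgue. x \<in> cell e \<inter> U \<longrightarrow>
          v x = (\<Sum>b\<in>ref_basis e. c e b *\<^sub>R b (inv_into (ref_cell e) (chart e) x))"
        using bspec[OF c that] by (simp add: AE_restrict_space_iff)
      then have "AE x in lebesgue. x \<in> U \<longrightarrow> x \<in> cell e \<longrightarrow>
          v x = (\<Sum>b\<in>ref_basis e. c e b *\<^sub>R b (inv_into (ref_cell e) (chart e) x))"
        by eventually_elim blast
      then show ?thesis using U by (simp add: AE_restrict_space_iff)
    qed
    then have "AE x in lebesgue_on U. \<forall>e\<in>\<T>. x \<in> cell e \<longrightarrow>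
        v x = (\<Sum>b\<in>ref_basis e. c e b *\<^sub>R b (inv_into (ref_cell e) (chart e) x))"
      using fin by (intro AE_finite_allI) auto
    moreover have "AE x in lebesgue_on U. x \<in> U"
      using AE_space[of "lebesgue_on U"] by simp
    ultimately have "AE x in lebesgue_on U. v x = (\<Sum>i\<in>?I. (case i of (e, b) \<Rightarrow> c e b) *\<^sub>R \<beta> i x)"
    proof eventually_elim
      case (elim x)
      let ?s = "\<lambda>e. \<Sum>b\<in>ref_basis e. c e b *\<^sub>R b (inv_into (ref_cell e) (chart e) x)"
      have "(\<Sum>i\<in>?I. (case i of (e, b) \<Rightarrow> c e b) *\<^sub>R \<beta> i x)
          = (\<Sum>e\<in>\<T>. \<Sum>b\<in>ref_basis e. c e b *\<^sub>R \<beta> (e, b) x)"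
        using fin by (subst sum.Sigma) (auto simp: split_def)
      also have "\<dots> = (\<Sum>e\<in>\<T>. if sel x = e then ?s e else 0)"
        by (intro sum.cong) (auto simp: \<beta>_def)
      also have "\<dots> = ?s (sel x)"
        using fin sel[OF elim(2)] by simp
      finally show ?case using elim sel[OF elim(2)] by simp
    qed
    then show ?thesis by blast
  qed
  moreover have "finite ?I" using fin by blast
  ultimately show ?thesis by blast
qed

subsection \<open>The inf-sup condition\<close>

lemma H1_space_subset_L2: "H1_space U \<subseteq> L2_space U"
  by (auto simp: H1_space_def)

lemma L2_norm_le_H1_norm: "L2_norm U v \<le> H1_norm U v"
  by (simp add: H1_norm_def L2_norm_nonneg)

lemma H1_norm_pos:
  assumes "v \<in> H1_space U" "\<not> ae_zero U v"
  shows "0 < H1_norm U v"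
  using assms H1_space_subset_L2[of U] L2_norm_eq_0_iff[of v U] L2_norm_nonneg[of U v]
    L2_norm_le_H1_norm[of U v]
  by (metis order_less_le order_less_le_trans subsetD)

text \<open>Orthogonality turns the squared norm of \<open>p\<close> into its inner product with
  \<open>w\<close>; Cauchy-Schwarz then leaves one factor to cancel.\<close>

lemma L2_norm_L2_projection_le:
  assumes w: "w \<in> L2_space U" and p: "p \<in> L2_space U"
    and orth: "L2_inner U (\<lambda>x. w x - p x) p = 0"
  shows "L2_norm U p \<le> L2_norm U w"
proof -
  have "(L2_norm U p)\<^sup>2 = L2_inner U w p"
    using orth L2_inner_diff_left[OF w p p] by (simp add: L2_inner_self)
  also have "\<dots> \<le> L2_norm U w * L2_norm U p"
    using L2_Cauchy_Schwarz[OF w p] by simp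
  finally have "L2_norm U p * L2_norm U p \<le> L2_norm U w * L2_norm U p"
    by (simp add: power2_eq_square)
  then show ?thesis
    using L2_norm_nonneg[of U p] L2_norm_nonneg[of U w]
    by (cases "L2_norm U p = 0") auto
qed

text \<open>The estimate for one fixed \<open>q\<close>. The operator \<open>P\<close> is described
  only by its range, orthogonality and stability, which keeps the epsilon choice out of the
  argument. In \<open>max 1 c\<close> the 1 bounds the L2 part of the norm and \<open>c\<close> the
  gradient part.\<close>

lemma inf_sup_ratio:
  fixes \<Omega> :: "(real^3) set" and \<D> :: "(real^3) set set"
  defines "\<Omega>f \<equiv> \<Union>\<D>"
  assumes open_sets: "open \<Omega>" "open \<Omega>f"
    and V: "(\<lambda>_. 0) \<in> V"
    and X: "linear_function_space X" "X \<subseteq> space_W \<Omega> \<D>"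
    and P_in: "\<And>w. w \<in> space_W \<Omega> \<D> \<Longrightarrow> P w \<in> X"
    and P_orth: "\<And>w q. w \<in> space_W \<Omega> \<D> \<Longrightarrow> q \<in> X \<Longrightarrow> L2_inner \<Omega>f (\<lambda>x. w x - P w x) q = 0"
    and P_stable: "\<And>w. w \<in> space_W \<Omega> \<D> \<Longrightarrow>
      L2_norm \<Omega>f (weak_grad \<Omega>f (P w)) \<le> c * L2_norm \<Omega>f (weak_grad \<Omega>f w)"
    and q: "q \<in> X" "\<not> ae_zero \<Omega>f q"
  shows "ereal (1 / max 1 c) \<le>
    (SUP (v, w)\<in>{(v, w). v \<in> V \<and> w \<in> X \<and> \<not> (ae_zero \<Omega> v \<and> ae_zero \<Omega>f w)}.
      ereal (L2_functional \<Omega>f q (\<lambda>x. v x - w x)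
        / (norm_VW \<Omega> \<Omega>f (v, w) * norm_Q \<Omega> \<D> (L2_functional \<Omega>f q))))"
    (is "_ \<le> ?S")
proof -
  let ?Z = "space_W \<Omega> \<D>"
  let ?W0 = "{w \<in> ?Z. \<not> ae_zero \<Omega>f w}"
  let ?H = "H1_norm \<Omega>f"
  let ?N = "norm_Q \<Omega> \<D> (L2_functional \<Omega>f q)"
  define \<Phi> where "\<Phi> = L2_functional \<Omega>f q"
  define M where "M = max 1 c"
  have M: "1 \<le> M" "c \<le> M" by (auto simp: M_def)
  have Z_H1: "?Z \<subseteq> H1_space \<Omega>f"
    by (auto simp: space_W_def H1_vanishing_def \<Omega>f_def)
  then have Z_L2: "?Z \<subseteq> L2_space \<Omega>f" using H1_space_subset_L2 by blast
  have qZ: "q \<in> ?Z" using q X by blast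
  have qL2: "q \<in> L2_space \<Omega>f" using qZ Z_L2 by blast
  have H_pos: "0 < ?H w" if "w \<in> ?W0" for w
    using that Z_H1 by (auto intro: H1_norm_pos)
  have N: "?N = (SUP w\<in>?W0. \<bar>\<Phi> w\<bar> / ?H w)"
    by (simp add: norm_Q_def \<Phi>_def \<Omega>f_def)
  \<comment> \<open>\<open>norm_Q\<close> is a real supremum, so its quotients must be bounded
    before it can be compared with them.\<close>
  have "\<bar>\<Phi> w\<bar> / ?H w \<le> L2_norm \<Omega>f q" if w: "w \<in> ?W0" for w
  proof -
    have "\<bar>\<Phi> w\<bar> \<le> L2_norm \<Omega>f q * L2_norm \<Omega>f w"
      using L2_Cauchy_Schwarz[OF qL2, of w] w Z_L2 by (auto simp: \<Phi>_def L2_functional_def)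
    also have "\<dots> \<le> L2_norm \<Omega>f q * ?H w"
      by (intro mult_left_mono L2_norm_le_H1_norm L2_norm_nonneg)
    finally show ?thesis using H_pos[OF w] by (simp add: field_simps)
  qed
  then have bdd: "bdd_above ((\<lambda>w. \<bar>\<Phi> w\<bar> / ?H w) ` ?W0)"
    by (intro bdd_aboveI2)
  have q0: "q \<in> ?W0" using q qZ by simp
  \<comment> \<open>Taking \<open>q\<close> itself as competitor shows that the dual norm is
    positive, so dividing by it is legitimate.\<close>
  have "L2_norm \<Omega>f q \<noteq> 0" using L2_norm_eq_0_iff[OF qL2] q by simp
  then have \<Phi>q: "0 < \<Phi> q" by (simp add: \<Phi>_def L2_functional_def L2_inner_self)
  then have "0 < \<bar>\<Phi> q\<bar> / ?H q" using H_pos[OF q0] by simp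
  also have "\<dots> \<le> ?N" unfolding N by (rule cSUP_upper[OF q0 bdd])
  finally have N_pos: "0 < ?N" .
  \<comment> \<open>A nonzero pairing guarantees that the projection of \<open>w\<close> is not zero
    almost everywhere, so that the test pair is admissible.\<close>
  have le_S: "ereal (\<bar>\<Phi> w\<bar> / (M * ?H w * ?N)) \<le> ?S" if w: "w \<in> ?W0" and nz: "\<Phi> w \<noteq> 0" for w
  proof -
    have wZ: "w \<in> ?Z" using w by simp
    then have wL2: "w \<in> L2_space \<Omega>f" using Z_L2 by blast
    have PX: "P w \<in> X" by (rule P_in[OF wZ])
    then have PL2: "P w \<in> L2_space \<Omega>f" and PH1: "P w \<in> H1_space \<Omega>f"
      using X Z_L2 Z_H1 by auto
    have P_le: "?H (P w) \<le> M * ?H w"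
    proof -
      have "L2_norm \<Omega>f (P w) \<le> 1 * L2_norm \<Omega>f w"
        using L2_norm_L2_projection_le[OF wL2 PL2 P_orth[OF wZ PX]] by simp
      also have "\<dots> \<le> M * L2_norm \<Omega>f w"
        using M by (intro mult_right_mono L2_norm_nonneg)
      finally have 1: "L2_norm \<Omega>f (P w) \<le> M * L2_norm \<Omega>f w" .
      have "L2_norm \<Omega>f (weak_grad \<Omega>f (P w)) \<le> c * L2_norm \<Omega>f (weak_grad \<Omega>f w)"
        by (rule P_stable[OF wZ])
      also have "\<dots> \<le> M * L2_norm \<Omega>f (weak_grad \<Omega>f w)"
        using M by (intro mult_right_mono L2_norm_nonneg)
      finally show ?thesis
        using 1 by (simp add: H1_norm_def distrib_left)
    qed
    have "L2_inner \<Omega>f (\<lambda>x. w x - P w x) q = 0" by (rule P_orth[OF wZ q(1)])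
    then have \<Phi>P: "L2_inner \<Omega>f q (P w) = \<Phi> w"
      using L2_inner_diff_left[OF wL2 PL2 qL2]
      by (simp add: \<Phi>_def L2_functional_def L2_inner_commute[of _ q])
    \<comment> \<open>The functional is applied to the difference of the pair, so with first
      component 0 the factor \<open>- s\<close> turns the pairing into the absolute value of
      \<open>\<Phi> w\<close>.\<close>
    define s where "s = sgn (\<Phi> w)"
    define wh where "wh = (\<lambda>x. (- s) *\<^sub>R P w x)"
    have whX: "wh \<in> X"
      unfolding wh_def using X PX unfolding linear_function_space_def by blast
    have "L2_inner \<Omega>f q wh = - s * \<Phi> w"
      unfolding wh_def L2_inner_scaleR_right \<Phi>P ..
    then have \<Phi>wh: "L2_inner \<Omega>f q wh = - \<bar>\<Phi> w\<bar>"
      by (simp add: s_def sgn_if)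
    then have wh_nz: "\<not> ae_zero \<Omega>f wh"
      using nz L2_inner_ae_zero by fastforce
    have val: "L2_functional \<Omega>f q (\<lambda>x. 0 - wh x) = \<bar>\<Phi> w\<bar>"
      using \<Phi>wh L2_inner_scaleR_right[of \<Omega>f q "-1" wh] by (simp add: L2_functional_def)
    have "?H wh = ?H (P w)"
    \<comment> \<open>For \<open>s = 1\<close> the sign is removed by \<open>H1_norm_minus\<close>;
      for \<open>s = -1\<close> the function \<open>wh\<close> is \<open>P w\<close> itself.\<close>
    proof (cases "0 < \<Phi> w")
      case True
      then show ?thesis
        using H1_norm_minus[OF open_sets(2) PH1] by (simp add: wh_def s_def)
    next
      case False
      then show ?thesis using nz by (simp add: wh_def s_def)
    qed
    moreover have "0 < ?H wh"
      using whX X Z_H1 wh_nz by (blast intro: H1_norm_pos)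
    ultimately have norm: "norm_VW \<Omega> \<Omega>f (\<lambda>_. 0, wh) = ?H (P w)" and PH_pos: "0 < ?H (P w)"
      by (auto simp: norm_VW_def H1_norm_zero[OF open_sets(1)])
    have "\<bar>\<Phi> w\<bar> / (M * ?H w * ?N) \<le> \<bar>\<Phi> w\<bar> / (?H (P w) * ?N)"
      using P_le N_pos PH_pos by (intro divide_left_mono mult_right_mono) (auto intro!: mult_pos_pos)
    then have "ereal (\<bar>\<Phi> w\<bar> / (M * ?H w * ?N))
        \<le> ereal (L2_functional \<Omega>f q (\<lambda>x. 0 - wh x) / (norm_VW \<Omega> \<Omega>f (\<lambda>_. 0, wh) * ?N))"
      by (simp only: val norm ereal_less_eq)
    also have "\<dots> \<le> ?S"
      using V whX wh_nz by (intro SUP_upper2[of "(\<lambda>_. 0, wh)"]) auto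
    finally show ?thesis .
  qed
  define S where "S = ?S"
  note le_S = le_S[folded S_def]
  have "ereal (1 / M) \<le> S"
  \<comment> \<open>Assuming the contrary makes the extended real \<open>S\<close> finite: it is
    below \<open>1 / M\<close>, and positive by the bound for \<open>q\<close>.\<close>
  proof (rule ccontr)
    assume "\<not> ?thesis"
    then have less: "S < ereal (1 / M)" by simp
    have "0 < \<bar>\<Phi> q\<bar> / (M * ?H q * ?N)"
      using \<Phi>q H_pos[OF q0] N_pos M by simp
    then have "0 < ereal (\<bar>\<Phi> q\<bar> / (M * ?H q * ?N))" by simp
    also have "\<dots> \<le> S" by (rule le_S[OF q0]) (use \<Phi>q in simp)
    finally have S_pos: "0 < S" .
    obtain s where s: "S = ereal s"
      using less S_pos by (cases S) auto
    have s_pos: "0 < s" "s < 1 / M" using S_pos less s by auto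
    \<comment> \<open>This bound is uniform in \<open>w\<close>, so the supremum gives
      \<open>?N \<le> s * M * ?N\<close>; cancelling \<open>?N\<close> contradicts
      \<open>s < 1 / M\<close>.\<close>
    have "\<bar>\<Phi> w\<bar> / ?H w \<le> s * M * ?N" if w: "w \<in> ?W0" for w
    proof (cases "\<Phi> w = 0")
      case True
      then show ?thesis using s_pos M N_pos by simp
    next
      case False
      have "\<bar>\<Phi> w\<bar> / (M * ?H w * ?N) \<le> s"
        using le_S[OF w False] unfolding s by simp
      then show ?thesis
        using H_pos[OF w] N_pos M by (simp add: field_simps)
    qed
    then have "?N \<le> s * M * ?N"
      unfolding N using q0 by (intro cSUP_least) auto
    then have "1 \<le> s * M" using N_pos by simp
    then show False using s_pos M by (simp add: field_simps)
  qed
  then show ?thesis by (simp only: M_def S_def)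
qed

theorem proposition3:
  fixes \<Omega> \<Omega>f :: "(real^3) set"
    and \<D> :: "(real^3) set set"
    and H :: "real set"
    and \<T>V \<T>W :: "real \<Rightarrow> fin_elem set"
    and V\<^sub>h W\<^sub>h :: "real \<Rightarrow> (real^3 \<Rightarrow> real^3) set"
  assumes "bounded \<Omega>" and "lipschitz_domain \<Omega>"
    and "finite \<D>" and "\<D> \<noteq> {}" and "\<forall>D\<in>\<D>. lipschitz_domain D"
    and "\<Omega>f = \<Union>\<D>" and "\<Omega>f \<subseteq> \<Omega>"
    and "lipschitz_domain (\<Omega> - closure \<Omega>f)"
    and "H \<subseteq> {0<..}"
    and "regular_mesh_family H \<Omega> \<T>V" and "regular_mesh_family H \<Omega>f \<T>W"
    and "\<forall>h\<in>H. h = max (mesh_size (\<T>V h)) (mesh_size (\<T>W h))"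
    and "\<forall>h\<in>H. fe_space \<Omega> (\<T>V h) (space_V \<Omega>) (V\<^sub>h h)"
    and "\<forall>h\<in>H. fe_space \<Omega>f (\<T>W h) (space_W \<Omega> \<D>) (W\<^sub>h h)"
    and "\<forall>h\<in>H. H1_L2_continuous \<Omega>f (space_W \<Omega> \<D>) (L2_projection \<Omega>f (W\<^sub>h h))"
    and "\<exists>c\<^sub>W>0. \<forall>h\<in>H. \<forall>w\<in>space_W \<Omega> \<D>.
           L2_norm \<Omega>f (weak_grad \<Omega>f (L2_projection \<Omega>f (W\<^sub>h h) w))
             \<le> c\<^sub>W * L2_norm \<Omega>f (weak_grad \<Omega>f w)"
  shows "\<exists>\<alpha>\<^sub>3>0. \<forall>h\<in>H.
           (INF q\<in>{q \<in> W\<^sub>h h. \<not> ae_zero \<Omega>f q}.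
             SUP (v, w)\<in>{(v, w). v \<in> V\<^sub>h h \<and> w \<in> W\<^sub>h h \<and> \<not> (ae_zero \<Omega> v \<and> ae_zero \<Omega>f w)}.
               ereal (L2_functional \<Omega>f q (\<lambda>x. v x - w x)
                        / (norm_VW \<Omega> \<Omega>f (v, w) * norm_Q \<Omega> \<D> (L2_functional \<Omega>f q))))
           \<ge> ereal \<alpha>\<^sub>3"
proof -
  obtain c where c: "\<And>h w. h \<in> H \<Longrightarrow> w \<in> space_W \<Omega> \<D> \<Longrightarrow>
      L2_norm \<Omega>f (weak_grad \<Omega>f (L2_projection \<Omega>f (W\<^sub>h h) w)) \<le> c * L2_norm \<Omega>f (weak_grad \<Omega>f w)"
    using assms(16) by blast
  have open_sets: "open \<Omega>" "open \<Omega>f"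
    using assms(2,5,6) by (auto simp: lipschitz_domain_def)
  have Z_L2: "space_W \<Omega> \<D> \<subseteq> L2_space \<Omega>f"
    using assms(6) by (auto simp: space_W_def H1_vanishing_def H1_space_def)
  show ?thesis
  \<comment> \<open>\<open>c\<close> was obtained before \<open>h\<close> is fixed, so the witness
    does not depend on \<open>h\<close>; the maximum with 1 keeps it positive.\<close>
  proof (intro exI[of _ "1 / max 1 c"] conjI ballI INF_greatest)
    fix h q assume h: "h \<in> H" and "q \<in> {q \<in> W\<^sub>h h. \<not> ae_zero \<Omega>f q}"
    then have q: "q \<in> W\<^sub>h h" "\<not> ae_zero \<Omega>f q" by auto
    have fe: "fe_space \<Omega>f (\<T>W h) (space_W \<Omega> \<D>) (W\<^sub>h h)" using assms(14) h by blast
    then have W: "linear_function_space (W\<^sub>h h)" "W\<^sub>h h \<subseteq> space_W \<Omega> \<D>"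
      by (auto simp: fe_space_def)
    have V: "(\<lambda>_. 0) \<in> V\<^sub>h h"
      using assms(13) h by (auto simp: fe_space_def linear_function_space_def)
    have "is_mesh \<Omega>f (\<T>W h)"
      using assms(11) h by (simp add: regular_mesh_family_def)
    from fe_space_finite_span[OF open_sets(2) this fe]
    obtain I :: "(fin_elem \<times> (real^3 \<Rightarrow> real^3)) set" and \<beta> where "finite I"
      "\<forall>v\<in>W\<^sub>h h. \<exists>c. AE x in lebesgue_on \<Omega>f. v x = (\<Sum>i\<in>I. c i *\<^sub>R \<beta> i x)"
      by blast
    then have "\<exists>p\<in>W\<^sub>h h. \<forall>q\<in>W\<^sub>h h. L2_inner \<Omega>f (\<lambda>x. w x - p x) q = 0" if "w \<in> space_W \<Omega> \<D>" for w
      using W Z_L2 that by (intro L2_projection_exists[where \<beta> = \<beta> and I = I]) auto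
    then have "\<exists>p. p \<in> W\<^sub>h h \<and> (\<forall>q\<in>W\<^sub>h h. L2_inner \<Omega>f (\<lambda>x. w x - p x) q = 0)" if "w \<in> space_W \<Omega> \<D>" for w
      using that by blast
    \<comment> \<open>Once a projection exists, the function selected in
      \<open>L2_projection\<close> has the membership and orthogonality properties.\<close>
    note proj = someI_ex[OF this, folded L2_projection_def]
    show "ereal (1 / max 1 c) \<le>
      (SUP (v, w)\<in>{(v, w). v \<in> V\<^sub>h h \<and> w \<in> W\<^sub>h h \<and> \<not> (ae_zero \<Omega> v \<and> ae_zero \<Omega>f w)}.
        ereal (L2_functional \<Omega>f q (\<lambda>x. v x - w x)
          / (norm_VW \<Omega> \<Omega>f (v, w) * norm_Q \<Omega> \<D> (L2_functional \<Omega>f q))))"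
      unfolding assms(6)
      by (rule inf_sup_ratio[where P = "L2_projection \<Omega>f (W\<^sub>h h)"])
        (use open_sets V W proj c[OF h] q assms(6) in auto)
  qed simp
qed

end
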